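(* Let $G$ be a graph with maximum degree $\Delta$ and boxicity $b\ge 3$. Then $G$ contains an induced (chordless) cycle of length at least $\lfloor \log_{\Delta}(b-2)\rfloor+2$.
   Context: The boxicity of $G$ is the minimum $b$ such that $G$ is the intersection graph of axis-parallel boxes in $\mathbb{R}^b$ (products of $b$ closed intervals), one box per vertex. An induced cycle is a cycle in $G$ with no chord (no edge of $G$ joining two non-consecutive vertices of the cycle). *)

theory Defs
  imports Complex_Main
begin

definition fin_simple_graph :: "'a set \<Rightarrow> ('a \<Rightarrow> 'a \<Rightarrow> bool) \<Rightarrow> bool" where
  "fin_simple_graph V E \<longleftrightarrow> finite V \<and> (\<forall>u v. E u v \<longrightarrow> E v u) \<and> (\<forall>v. \<not> E v v)
     \<and> (\<forall>u v. E u v \<longrightarrow> u \<in> V \<and> v \<in> V)"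

definition degree :: "'a set \<Rightarrow> ('a \<Rightarrow> 'a \<Rightarrow> bool) \<Rightarrow> 'a \<Rightarrow> nat" where
  "degree V E v = card {w \<in> V. E v w}"

definition max_degree :: "'a set \<Rightarrow> ('a \<Rightarrow> 'a \<Rightarrow> bool) \<Rightarrow> nat" where
  "max_degree V E = Max (degree V E ` V)"

text \<open>A box representation in R^d: vertex v gets the box
  prod_{i<d} [fst (B v i), snd (B v i)] (nonempty closed intervals); distinct vertices are
  adjacent iff their boxes intersect, i.e. iff the intervals intersect in every coordinate.\<close>
definition box_rep :: "'a set \<Rightarrow> ('a \<Rightarrow> 'a \<Rightarrow> bool) \<Rightarrow> nat \<Rightarrow> ('a \<Rightarrow> nat \<Rightarrow> real \<times> real) \<Rightarrow> bool" where
  "box_rep V E d B \<longleftrightarrow>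
     (\<forall>v\<in>V. \<forall>i<d. fst (B v i) \<le> snd (B v i)) \<and>
     (\<forall>u\<in>V. \<forall>v\<in>V. u \<noteq> v \<longrightarrow>
        (E u v \<longleftrightarrow> (\<forall>i<d. {fst (B u i)..snd (B u i)} \<inter> {fst (B v i)..snd (B v i)} \<noteq> {})))"

definition boxicity :: "'a set \<Rightarrow> ('a \<Rightarrow> 'a \<Rightarrow> bool) \<Rightarrow> nat" where
  "boxicity V E = (LEAST d. \<exists>B. box_rep V E d B)"

definition induced_cycle :: "'a set \<Rightarrow> ('a \<Rightarrow> 'a \<Rightarrow> bool) \<Rightarrow> 'a list \<Rightarrow> bool" where
  "induced_cycle V E cs \<longleftrightarrow> distinct cs \<and> set cs \<subseteq> V \<and> length cs \<ge> 3 \<and>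
     (\<forall>i<length cs. \<forall>j<length cs.
        E (cs!i) (cs!j) \<longleftrightarrow> (j = Suc i mod length cs \<or> i = Suc j mod length cs))"

end

(* The boxicity bound comes from a monotone cops-and-robber strategy.  Suppose m >= 2 and every
   induced cycle has fewer than m + 2 vertices.  Keep an induced path P and a territory C whose
   outer neighbours all lie in N(P).  If C is connected and both ends of P have a private neighbour
   bordering C, then P together with a shortest path through C is an induced cycle, so P has fewer
   than m vertices and can be prolonged by a private neighbour of its head, which shrinks C;
   otherwise an end of P can be dropped.  So m * D cops suffice (D the maximum degree).  The order
   in which the vertices are occupied, and the cops occupying them, yield m * D + 1 interval graphs
   whose intersection is the graph, and m * D <= D^m.  The remaining case, that a graph without
   induced cycles has boxicity at most 2, is treated separately, with coordinates given by
   depth-first intervals and by depth. *)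

theory Submission
  imports Defs
begin

section \<open>Sweeping orders and their composition\<close>

definition boundary :: "('a \<Rightarrow> 'a \<Rightarrow> bool) \<Rightarrow> 'a set \<Rightarrow> 'a set" where
  "boundary E C = {w. w \<notin> C \<and> (\<exists>c\<in>C. E c w)}"

definition nbhd :: "('a \<Rightarrow> 'a \<Rightarrow> bool) \<Rightarrow> 'a set \<Rightarrow> 'a set" where
  "nbhd E P = {w. \<exists>v\<in>P. E v w}"

text \<open>The empty list counts as an induced path; it is the guide path before any vertex has
  been occupied.\<close>

definition induced_path :: "('a \<Rightarrow> 'a \<Rightarrow> bool) \<Rightarrow> 'a list \<Rightarrow> bool" where
  "induced_path E ps \<longleftrightarrow> distinct ps \<and>
     (\<forall>i<length ps. \<forall>j<length ps. E (ps ! i) (ps ! j) \<longleftrightarrow> (j = Suc i \<or> i = Suc j))"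

text \<open>\<open>pos\<close> is the time a vertex gets occupied and \<open>col\<close> is the cop used; vertices of \<open>S\<close> count as
  occupied before \<open>C\<close>. Whenever the cop on \<open>u\<close> is reused for \<open>u'\<close> before a neighbour \<open>w\<close> of \<open>u\<close> is
  occupied, \<open>u'\<close> must be in a branch already finished at time \<open>pos w\<close>.\<close>

definition well_ordered_colouring ::
    "('a \<Rightarrow> 'a \<Rightarrow> bool) \<Rightarrow> 'a set \<Rightarrow> 'a set \<Rightarrow> ('a \<Rightarrow> nat) \<Rightarrow> ('a \<Rightarrow> nat) \<Rightarrow> bool" where
  "well_ordered_colouring E S C pos col \<longleftrightarrow>
     (\<forall>u\<in>S \<union> C. \<forall>u'\<in>C. \<forall>w\<in>C.
        E u w \<and> (u \<in> C \<longrightarrow> pos u < pos u') \<and> pos u' \<le> pos w \<and> col u' = col u \<longrightarrow>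
        u' \<noteq> w \<and> (\<forall>z\<in>C. E u' z \<longrightarrow> pos z < pos w))"

text \<open>Here \<open>p\<close> is the number of cops. Quantifying over every injective
  \<open>col\<close> on \<open>S\<close> and every start time \<open>n\<close> is what permits
  gluing: a branch has to accept the cops as they already stand on \<open>S\<close>, and has to be
  able to start arbitrarily late.\<close>

definition sweepable :: "('a \<Rightarrow> 'a \<Rightarrow> bool) \<Rightarrow> nat \<Rightarrow> 'a set \<Rightarrow> 'a set \<Rightarrow> bool" where
  "sweepable E p S C \<longleftrightarrow>
     (\<forall>col n. inj_on col S \<and> col ` S \<subseteq> {..<p} \<longrightarrow>
        (\<exists>pos col'. (\<forall>v\<in>S. col' v = col v) \<and> col' ` C \<subseteq> {..<p} \<and> inj_on pos C \<and>
           (\<forall>v\<in>C. n \<le> pos v) \<and> well_ordered_colouring E S C pos col'))"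

lemma sweepableE:
  assumes "sweepable E p S C" "inj_on col S" "col ` S \<subseteq> {..<p}"
  obtains pos col' where "\<forall>v\<in>S. col' v = col v" "col' ` C \<subseteq> {..<p}" "inj_on pos C"
    "\<forall>v\<in>C. n \<le> pos v" "well_ordered_colouring E S C pos col'"
proof -
  from assms have "\<exists>pos col'. (\<forall>v\<in>S. col' v = col v) \<and> col' ` C \<subseteq> {..<p} \<and> inj_on pos C \<and>
           (\<forall>v\<in>C. n \<le> pos v) \<and> well_ordered_colouring E S C pos col'"
    unfolding sweepable_def by blast
  then show thesis using that by blast
qed

lemma sweepableI:
  assumes "\<And>col n. inj_on col S \<Longrightarrow> col ` S \<subseteq> {..<p} \<Longrightarrow>
    \<exists>pos col'. (\<forall>v\<in>S. col' v = col v) \<and> col' ` C \<subseteq> {..<p} \<and> inj_on pos C \<and>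
           (\<forall>v\<in>C. n \<le> pos v) \<and> well_ordered_colouring E S C pos col'"
  shows "sweepable E p S C"
  using assms unfolding sweepable_def by blast

lemma well_ordered_colouringD:
  assumes "well_ordered_colouring E S C pos col" "u \<in> S \<union> C" "u' \<in> C" "w \<in> C" "E u w"
    "u \<in> C \<Longrightarrow> pos u < pos u'" "pos u' \<le> pos w" "col u' = col u"
  shows "u' \<noteq> w" "z \<in> C \<Longrightarrow> E u' z \<Longrightarrow> pos z < pos w"
  using assms unfolding well_ordered_colouring_def by blast+

lemma well_ordered_colouringI:
  assumes "\<And>u u' w. u \<in> S \<union> C \<Longrightarrow> u' \<in> C \<Longrightarrow> w \<in> C \<Longrightarrow> E u w \<Longrightarrow>
    (u \<in> C \<Longrightarrow> pos u < pos u') \<Longrightarrow> pos u' \<le> pos w \<Longrightarrow> col u' = col u \<Longrightarrow>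
    u' \<noteq> w \<and> (\<forall>z\<in>C. E u' z \<longrightarrow> pos z < pos w)"
  shows "well_ordered_colouring E S C pos col"
  using assms unfolding well_ordered_colouring_def by blast

lemma sweepable_empty: "sweepable E p S {}"
  by (rule sweepableI) (auto simp: well_ordered_colouring_def)

text \<open>A vertex \<open>u\<close> is constrained only through its neighbours \<open>w\<close> in
  \<open>C\<close>. A vertex of \<open>S\<close> outside \<open>S'\<close> has none, so its cop is
  free and its colour may return inside \<open>C\<close>.\<close>

lemma sweepable_mono:
  assumes "sweepable E p S' C" "S' \<subseteq> S" "S \<inter> C = {}" and sym: "\<And>u v. E u v \<Longrightarrow> E v u"
    and "boundary E C \<subseteq> S'"
  shows "sweepable E p S C"
proof (rule sweepableI)
  fix col :: "'a \<Rightarrow> nat" and n :: nat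
  assume c: "inj_on col S" "col ` S \<subseteq> {..<p}"
  have c': "inj_on col S'" "col ` S' \<subseteq> {..<p}"
    using c assms(2) by (auto intro: inj_on_subset)
  obtain pos col' where h: "\<forall>v\<in>S'. col' v = col v" "col' ` C \<subseteq> {..<p}" "inj_on pos C"
    "\<forall>v\<in>C. n \<le> pos v" "well_ordered_colouring E S' C pos col'"
    by (rule sweepableE[OF assms(1) c', of n])
  \<comment> \<open>\<open>col'\<close> is known to extend \<open>col\<close> only on
    \<open>S'\<close>; it is therefore kept on \<open>C\<close> alone, and \<open>col\<close> is
    restored elsewhere.\<close>
  let ?c = "\<lambda>v. if v \<in> C then col' v else col v"
  have "well_ordered_colouring E S C pos ?c"
  proof (rule well_ordered_colouringI)
    fix u u' w
    assume a: "u \<in> S \<union> C" "u' \<in> C" "w \<in> C" "E u w" "u \<in> C \<Longrightarrow> pos u < pos u'"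
      "pos u' \<le> pos w" "?c u' = ?c u"
    have "u \<in> C \<or> u \<in> S'"
      using a sym assms(5) unfolding boundary_def by blast
    moreover from this have "col' u' = col' u"
      using a h(1) by (auto split: if_splits)
    ultimately show "u' \<noteq> w \<and> (\<forall>z\<in>C. E u' z \<longrightarrow> pos z < pos w)"
      using well_ordered_colouringD[OF h(5), of u u' w] a by blast
  qed
  moreover have "\<forall>v\<in>S. ?c v = col v" using assms(3) by auto
  moreover have "?c ` C \<subseteq> {..<p}" using h(2) by auto
  ultimately show "\<exists>pos col'. (\<forall>v\<in>S. col' v = col v) \<and> col' ` C \<subseteq> {..<p} \<and> inj_on pos C \<and>
           (\<forall>v\<in>C. n \<le> pos v) \<and> well_ordered_colouring E S C pos col'"
    using h(3,4) by (intro exI[of _ pos] exI[of _ ?c] conjI ballI) auto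
qed

text \<open>\<open>A\<close> is swept completely before \<open>B\<close>, both starting from the
  same cops on \<open>S\<close>. As no edge joins \<open>A\<close> to \<open>B\<close>, the cops
  used in \<open>A\<close> are free again for \<open>B\<close>.\<close>

lemma sweepable_Un:
  assumes A: "sweepable E p S A" and B: "sweepable E p S B"
    and fin: "finite A" and disj: "A \<inter> B = {}" "S \<inter> (A \<union> B) = {}"
    and sym: "\<And>u v. E u v \<Longrightarrow> E v u"
    and sep: "\<And>a b. a \<in> A \<Longrightarrow> b \<in> B \<Longrightarrow> \<not> E a b"
  shows "sweepable E p S (A \<union> B)"
proof (rule sweepableI)
  fix col :: "'a \<Rightarrow> nat" and n :: nat
  assume c: "inj_on col S" "col ` S \<subseteq> {..<p}"
  obtain pos1 col1 where h1: "\<forall>v\<in>S. col1 v = col v" "col1 ` A \<subseteq> {..<p}"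
    "inj_on pos1 A" "\<forall>v\<in>A. n \<le> pos1 v" "well_ordered_colouring E S A pos1 col1"
    by (rule sweepableE[OF A c, of n])
  \<comment> \<open>The sum bounds each single time on \<open>A\<close>, so \<open>N\<close> lies
    beyond all of them and beyond \<open>n\<close>.\<close>
  define N where "N = n + Suc (\<Sum>a\<in>A. pos1 a)"
  have N: "pos1 a < N" if "a \<in> A" for a
    using member_le_sum[OF that, of pos1] fin by (simp add: N_def)
  obtain pos2 col2 where h2: "\<forall>v\<in>S. col2 v = col v" "col2 ` B \<subseteq> {..<p}"
    "inj_on pos2 B" "\<forall>v\<in>B. N \<le> pos2 v" "well_ordered_colouring E S B pos2 col2"
    by (rule sweepableE[OF B c, of N])
  define pos where "pos v = (if v \<in> A then pos1 v else pos2 v)" for v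
  define col' where "col' v = (if v \<in> A then col1 v else col2 v)" for v
  have lt: "pos a < pos b" if "a \<in> A" "b \<in> B" for a b
    using N[of a] h2(4)[rule_format, of b] that disj(1) by (auto simp: pos_def)
  have eqA: "pos v = pos1 v" "col' v = col1 v" if "v \<in> A" for v
    using that by (auto simp: pos_def col'_def)
  have eqB: "pos v = pos2 v" "col' v = col2 v" if "v \<in> B" for v
    using that disj(1) by (auto simp: pos_def col'_def)
  have eqS: "col' v = col v" "col1 v = col v" "col2 v = col v" if "v \<in> S" for v
    using that h1(1) h2(1) by (auto simp: col'_def)
  have sep': "\<not> E b a" if "a \<in> A" "b \<in> B" for a b
    using that sep sym by blast
  have "well_ordered_colouring E S (A \<union> B) pos col'"
  proof (rule well_ordered_colouringI)
    fix u u' w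
    assume a: "u \<in> S \<union> (A \<union> B)" "u' \<in> A \<union> B" "w \<in> A \<union> B" "E u w"
      "u \<in> A \<union> B \<Longrightarrow> pos u < pos u'" "pos u' \<le> pos w" "col' u' = col' u"
    show "u' \<noteq> w \<and> (\<forall>z\<in>A \<union> B. E u' z \<longrightarrow> pos z < pos w)"
    proof (cases "w \<in> A")
      case True
      have u': "u' \<in> A" using a(2,6) lt[OF True, of u'] by auto
      have u: "u \<in> S \<union> A" using a(1,4) sep'[OF True, of u] by auto
      have col1: "col1 u' = col1 u" using a(7) u u' eqA eqS by auto
      have prec: "u \<in> A \<Longrightarrow> pos1 u < pos1 u'" using a(5) eqA u' by auto
      have le: "pos1 u' \<le> pos1 w" using a(6) eqA u' True by auto
      note r = well_ordered_colouringD[OF h1(5) u u' True a(4) prec le col1]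
      show ?thesis using r u' sep eqA True by (metis Un_iff)
    next
      case False
      then have wB: "w \<in> B" using a(3) by blast
      have u: "u \<in> S \<union> B" using a(1,4) sep[OF _ wB, of u] by auto
      show ?thesis
      proof (cases "u' \<in> A")
        case True
        \<comment> \<open>The exemption for finished branches: all neighbours of \<open>u'\<close>
          within \<open>A \<union> B\<close> lie in \<open>A\<close>, hence before
          \<open>w\<close>.\<close>
        then show ?thesis using False sep lt wB by blast
      next
        case False
        then have u': "u' \<in> B" using a(2) by blast
        have col2: "col2 u' = col2 u" using a(7) u u' eqB eqS by auto
        have prec: "u \<in> B \<Longrightarrow> pos2 u < pos2 u'" using a(5) eqB u' by auto
        have le: "pos2 u' \<le> pos2 w" using a(6) eqB u' wB by auto
        note r = well_ordered_colouringD[OF h2(5) u u' wB a(4) prec le col2]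
        show ?thesis using r u' sep' eqB wB by (metis Un_iff)
      qed
    qed
  qed
  moreover have "inj_on pos (A \<union> B)"
  proof (rule inj_onI)
    fix x y assume "x \<in> A \<union> B" "y \<in> A \<union> B" "pos x = pos y"
    then show "x = y" using lt[of x y] lt[of y x] eqA(1) eqB(1) h1(3) h2(3)
      by (metis Un_iff inj_onD nat_neq_iff)
  qed
  moreover have "col' ` (A \<union> B) \<subseteq> {..<p}" using h1(2) h2(2) eqA(2) eqB(2) by fastforce
  moreover have "n \<le> pos v" if "v \<in> A \<union> B" for v
    using that h1(4)[rule_format, of v] h2(4)[rule_format, of v] eqA(1) eqB(1) N_def by auto
  ultimately show "\<exists>pos col'. (\<forall>v\<in>S. col' v = col v) \<and> col' ` (A \<union> B) \<subseteq> {..<p} \<and>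
      inj_on pos (A \<union> B) \<and> (\<forall>v\<in>A \<union> B. n \<le> pos v) \<and> well_ordered_colouring E S (A \<union> B) pos col'"
    using eqS by (intro exI[of _ pos] exI[of _ col'] conjI ballI) simp_all
qed

text \<open>Since \<open>card S < p\<close>, some colour is free. The vertex \<open>v\<close> takes
  it at time \<open>n\<close>, and the rest is swept from time \<open>Suc n\<close> on with
  \<open>v\<close> counted among the occupied vertices.\<close>

lemma sweepable_place:
  assumes sw: "sweepable E p (insert v S) (C - {v})" and v: "v \<in> C" "v \<notin> S"
    and S: "finite S" "card S < p"
  shows "sweepable E p S C"
proof (rule sweepableI)
  fix col :: "'a \<Rightarrow> nat" and n :: nat
  assume c: "inj_on col S" "col ` S \<subseteq> {..<p}"
  have "col ` S \<noteq> {..<p}" using card_image[OF c(1)] S by auto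
  then obtain k where k: "k < p" "k \<notin> col ` S" using c(2) by auto
  have ins: "inj_on (col(v := k)) (insert v S)" "(col(v := k)) ` insert v S \<subseteq> {..<p}"
    using c k v(2) by (auto simp: inj_on_def)
  obtain pos col' where h: "\<forall>x\<in>insert v S. col' x = (col(v := k)) x"
    "col' ` (C - {v}) \<subseteq> {..<p}" "inj_on pos (C - {v})" "\<forall>x\<in>C - {v}. Suc n \<le> pos x"
    "well_ordered_colouring E (insert v S) (C - {v}) pos col'"
    by (rule sweepableE[OF sw ins, of "Suc n"])
  define pos' where "pos' = pos(v := n)"
  have px: "pos' x = pos x" if "x \<noteq> v" for x
    using that by (auto simp: pos'_def)
  have gt: "n < pos' x" if "x \<in> C" "x \<noteq> v" for x
    using h(4)[rule_format, of x] that px by auto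
  have cv: "col' v = k" using h(1) by simp
  have cS: "col' x = col x" if "x \<in> S" for x
    using h(1) that v(2) by auto
  have "well_ordered_colouring E S C pos' col'"
  proof (rule well_ordered_colouringI)
    fix u u' w
    assume a: "u \<in> S \<union> C" "u' \<in> C" "w \<in> C" "E u w" "u \<in> C \<Longrightarrow> pos' u < pos' u'"
      "pos' u' \<le> pos' w" "col' u' = col' u"
    \<comment> \<open>As \<open>v\<close> comes first in \<open>C\<close>, the vertex
      \<open>u\<close> would have to lie in \<open>S\<close>, where the colour \<open>k\<close> does
      not occur.\<close>
    have u'v: "u' \<noteq> v"
    proof
      assume eq: "u' = v"
      then have "u \<notin> C" using a(5) gt[of u] eq by (cases "u = v") (auto simp: pos'_def)
      then have "u \<in> S" using a(1) by blast
      then show False using a(7) eq cv cS k(2) by auto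
    qed
    then have "w \<noteq> v" using a(6) gt[OF a(2)] pos'_def by auto
    then have w: "w \<in> C - {v}" using a by blast
    have u': "u' \<in> C - {v}" using a u'v by blast
    have u: "u \<in> insert v S \<union> (C - {v})" using a by blast
    have prec: "u \<in> C - {v} \<Longrightarrow> pos u < pos u'" using a(5) px u'v by auto
    have le: "pos u' \<le> pos w" using a(6) px u'v w by auto
    note r = well_ordered_colouringD[OF h(5) u u' w a(4) prec le a(7)]
    have "pos' z < pos' w" if "z \<in> C" "E u' z" for z
      using r(2)[of z] that w gt[of w] px[of z] px[of w] by (cases "z = v") (auto simp: pos'_def)
    then show "u' \<noteq> w \<and> (\<forall>z\<in>C. E u' z \<longrightarrow> pos' z < pos' w)"
      using r(1) by blast
  qed
  moreover have "inj_on pos' C"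
  proof (rule inj_onI)
    fix x y assume xy: "x \<in> C" "y \<in> C" "pos' x = pos' y"
    show "x = y"
      using xy gt[of x] gt[of y] pos'_def inj_onD[OF h(3), of x y]
      by (cases "x = v"; cases "y = v") auto
  qed
  moreover have "col' ` C \<subseteq> {..<p}" using h(2) cv k(1) by (metis insert_Diff image_insert insert_subset lessThan_iff v(1))
  moreover have "n \<le> pos' x" if "x \<in> C" for x
    using gt[of x] that by (cases "x = v") (auto simp: pos'_def)
  ultimately show "\<exists>pos col'. (\<forall>v\<in>S. col' v = col v) \<and> col' ` C \<subseteq> {..<p} \<and> inj_on pos C \<and>
           (\<forall>v\<in>C. n \<le> pos v) \<and> well_ordered_colouring E S C pos col'"
    using cS by (intro exI[of _ pos'] exI[of _ col'] conjI ballI) simp_all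
qed

lemma sweepable_place_set:
  assumes "finite A" "A \<subseteq> C" "finite S" "S \<inter> C = {}" "card (S \<union> A) \<le> p"
    "sweepable E p (S \<union> A) (C - A)"
  shows "sweepable E p S C"
  using assms
proof (induction A arbitrary: S C rule: finite_induct)
  case empty
  then show ?case by simp
next
  case (insert a A)
  have aS: "a \<notin> S" using insert.prems by blast
  have eq: "insert a S \<union> A = S \<union> insert a A" "C - {a} - A = C - insert a A" by auto
  have "insert a S \<subseteq> S \<union> insert a A" by blast
  then have "card (insert a S) \<le> p"
    using insert.prems(4) card_mono[of "S \<union> insert a A" "insert a S"] insert.prems(2) insert.hyps(1)
    by (meson finite_UnI finite_insert le_trans)
  then have "card S < p" using aS insert.prems(2) by simp
  moreover have "sweepable E p (insert a S) (C - {a})"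
    by (rule insert.IH) (use insert.prems insert.hyps eq in auto)
  ultimately show ?case
    using sweepable_place[of E p a S C] aS insert.prems by blast
qed

section \<open>Box representations from sweeping orders\<close>

lemma intervals_meet_iff:
  fixes a b c d :: real
  assumes "a \<le> b" "c \<le> d"
  shows "{a..b} \<inter> {c..d} \<noteq> {} \<longleftrightarrow> a \<le> d \<and> c \<le> b"
proof -
  have "{a..b} \<inter> {c..d} = {max a c..min b d}" by auto
  then show ?thesis using assms by auto
qed

text \<open>Coordinate \<open>i < p\<close> separates the vertices coloured \<open>i\<close> (shrunk to points) from their later
  non-neighbours; coordinate \<open>p\<close> separates \<open>u\<close> from all vertices after its last neighbour.\<close>

lemma box_rep_of_sweepable:
  assumes G: "fin_simple_graph V E" and sw: "sweepable E p {} V"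
  shows "\<exists>B. box_rep V E (Suc p) B"
proof -
  have fin: "finite V" and sym: "\<And>u v. E u v \<Longrightarrow> E v u" and EV: "\<And>u v. E u v \<Longrightarrow> u \<in> V \<and> v \<in> V"
    using G unfolding fin_simple_graph_def by blast+
  obtain pos col where h: "col ` V \<subseteq> {..<p}" "inj_on pos V" "well_ordered_colouring E {} V pos col"
    by (rule sweepableE[OF sw, of "\<lambda>_. 0" 0]) auto
  define N where "N = (\<Sum>v\<in>V. pos v)"
  have N: "pos v \<le> N" if "v \<in> V" for v
    using member_le_sum[OF that, of pos] fin by (simp add: N_def)
  \<comment> \<open>Inserting \<open>v\<close> itself keeps the sets nonempty, so \<open>Max\<close>
    and \<open>Min\<close> are meaningful even for isolated vertices and for colours absent among
    the neighbours.\<close>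
  define hi where "hi v = Max (pos ` insert v {w. E v w})" for v
  define lo where "lo v i = Min (pos ` insert v {u. E u v \<and> col u = i})" for v i
  have finn: "finite {w. E v w}" "finite {u. E u v \<and> col u = i}" for v i
    using fin EV by (auto intro: finite_subset[of _ V])
  have hi_ge: "pos v \<le> hi v" "E v w \<Longrightarrow> pos w \<le> hi v" for v w
    unfolding hi_def using finn by (auto intro!: Max_ge)
  have hi_wit: "\<exists>w. (w = v \<or> E v w) \<and> pos w = hi v" for v
    using Max_in[of "pos ` insert v {w. E v w}"] finn unfolding hi_def by auto
  have lo_le: "lo v i \<le> pos v" "E u v \<Longrightarrow> lo v (col u) \<le> pos u" for v i u
    unfolding lo_def using finn by (auto intro!: Min_le)
  have lo_wit: "\<exists>u. (u = v \<or> E u v \<and> col u = i) \<and> pos u = lo v i" for v i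
    using Min_in[of "pos ` insert v {u. E u v \<and> col u = i}"] finn unfolding lo_def by auto
  \<comment> \<open>In coordinate \<open>i < p\<close> all vertices not coloured \<open>i\<close>
    reach up to \<open>N\<close>, so this coordinate never separates two of them.\<close>
  define B :: "'a \<Rightarrow> nat \<Rightarrow> real \<times> real" where
    "B v i = (if i < p then (if col v = i then (real (pos v), real (pos v)) else (real (lo v i), real N))
              else (real (pos v), real (hi v)))" for v i
  have le: "fst (B v i) \<le> snd (B v i)" if "v \<in> V" for v i
    using N[OF that] lo_le(1)[of v i] hi_ge(1)[of v] unfolding B_def by auto
  have meet: "({fst (B u i)..snd (B u i)} \<inter> {fst (B v i)..snd (B v i)} \<noteq> {}) \<longleftrightarrow>
      fst (B u i) \<le> snd (B v i) \<and> fst (B v i) \<le> snd (B u i)" if "u \<in> V" "v \<in> V" for u v i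
    using intervals_meet_iff le that by blast
  \<comment> \<open>The colouring condition with \<open>u' = w\<close> says that adjacent vertices
    differ in colour.\<close>
  have edge: "col u \<noteq> col w" if "E u w" "pos u < pos w" for u w
    using well_ordered_colouringD(1)[OF h(3), of u w w] that EV by auto
  \<comment> \<open>Common points for an edge: \<open>pos u\<close> in coordinate
    \<open>col u\<close>, \<open>pos w\<close> in the coordinates \<open>col w\<close> and
    \<open>p\<close>, and \<open>N\<close> in the remaining coordinates below
    \<open>p\<close>.\<close>
  have edge_meet: "fst (B u i) \<le> snd (B w i) \<and> fst (B w i) \<le> snd (B u i)"
    if uw: "E u w" "pos u < pos w" for u w i
  proof -
    have V: "u \<in> V" "w \<in> V" using that EV by blast+
    have ne: "col u \<noteq> col w" using edge that by blast
    have "lo u (col w) \<le> pos u" "lo w (col u) \<le> pos u" "pos w \<le> hi u"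
      using lo_le that hi_ge by blast+
    moreover have "lo u i \<le> N" "lo w i \<le> N" using lo_le(1) N V le_trans by blast+
    moreover have "pos u \<le> N" "pos w \<le> N" "pos w \<le> hi w" using N V hi_ge by auto
    ultimately show ?thesis using ne that(2) unfolding B_def by auto
  qed
  have nonedge: "\<exists>i<Suc p. \<not> (fst (B u i) \<le> snd (B w i) \<and> fst (B w i) \<le> snd (B u i))"
    if "\<not> E u w" "pos u < pos w" "u \<in> V" "w \<in> V" for u w
  proof (cases "pos w \<le> hi u")
    case False
    then have "\<not> (fst (B w p) \<le> snd (B u p))" unfolding B_def by auto
    then show ?thesis by blast
  next
    case True
    obtain z where z: "E u z" "pos w \<le> pos z"
      using hi_wit[of u] True \<open>pos u < pos w\<close> by auto
    let ?i = "col u"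
    have i: "?i < p" using h(1) \<open>u \<in> V\<close> by auto
    \<comment> \<open>Otherwise a neighbour \<open>t\<close> of \<open>w\<close> before
      \<open>u\<close> has the colour of \<open>u\<close>: its cop is reused for \<open>u\<close>
      before \<open>w\<close> is occupied. Then all neighbours of \<open>u\<close> come before
      \<open>w\<close>, which \<open>z\<close> contradicts.\<close>
    have "pos u < lo w ?i"
    proof -
      obtain t where t: "t = w \<or> E t w \<and> col t = ?i" "pos t = lo w ?i" using lo_wit by blast
      show ?thesis
      proof (cases "t = w")
        case False
        then have tw: "E t w" "col t = ?i" using t by auto
        have tV: "t \<in> V" using tw EV by blast
        have "t \<noteq> u" using tw that(1) by blast
        then have ne: "pos t \<noteq> pos u" using inj_onD[OF h(2)] tV that(3) by blast
        show ?thesis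
        proof (rule ccontr)
          assume "\<not> pos u < lo w ?i"
          then have "pos t < pos u" using ne t by simp
          then have "pos z < pos w"
            using well_ordered_colouringD(2)[OF h(3), of t u w z] tV that tw z EV by auto
          then show False using z by simp
        qed
      qed (use t that in auto)
    qed
    then have "\<not> (fst (B w ?i) \<le> snd (B u ?i))" using i that(2) unfolding B_def by auto
    then show ?thesis using i less_SucI by blast
  qed
  have "box_rep V E (Suc p) B"
    unfolding box_rep_def
  proof (intro conjI ballI allI impI)
    fix u v assume uv: "u \<in> V" "v \<in> V" "u \<noteq> v"
    then have "pos u < pos v \<or> pos v < pos u" using inj_on_eq_iff[OF h(2), of u v] by linarith
    then show "E u v \<longleftrightarrow> (\<forall>i<Suc p. {fst (B u i)..snd (B u i)} \<inter> {fst (B v i)..snd (B v i)} \<noteq> {})"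
      using edge_meet[of u v] edge_meet[of v u] nonedge[of u v] nonedge[of v u] meet uv sym by metis
  qed (use le in auto)
  then show ?thesis by blast
qed

section \<open>Induced paths and induced cycles\<close>

lemma induced_pathD:
  assumes "induced_path E ps" "i < length ps" "j < length ps"
  shows "E (ps ! i) (ps ! j) \<longleftrightarrow> j = Suc i \<or> i = Suc j"
  using assms unfolding induced_path_def by blast

lemma induced_pathI:
  assumes "distinct ps"
    "\<And>i j. i < length ps \<Longrightarrow> j < length ps \<Longrightarrow> E (ps ! i) (ps ! j) \<longleftrightarrow> j = Suc i \<or> i = Suc j"
  shows "induced_path E ps"
  using assms unfolding induced_path_def by blast

lemma induced_path_distinct: "induced_path E ps \<Longrightarrow> distinct ps"
  unfolding induced_path_def by blast

lemma induced_path_take: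
  assumes "induced_path E ps"
  shows "induced_path E (take n ps)"
  by (rule induced_pathI) (simp_all add: induced_path_distinct[OF assms] induced_pathD[OF assms])

lemma induced_path_drop:
  assumes "induced_path E ps"
  shows "induced_path E (drop n ps)"
proof (rule induced_pathI)
  fix i j assume "i < length (drop n ps)" "j < length (drop n ps)"
  then show "E (drop n ps ! i) (drop n ps ! j) \<longleftrightarrow> j = Suc i \<or> i = Suc j"
    using induced_pathD[OF assms, of "n + i" "n + j"] by simp
qed (simp add: induced_path_distinct[OF assms])

lemma induced_path_Cons:
  assumes ps: "induced_path E ps" and z: "z \<notin> set ps" "\<not> E z z" and sym: "\<And>u v. E u v \<Longrightarrow> E v u"
    and adj: "\<And>j. j < length ps \<Longrightarrow> E z (ps ! j) \<longleftrightarrow> j = 0"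
  shows "induced_path E (z # ps)"
proof (rule induced_pathI)
  fix i j assume ij: "i < length (z # ps)" "j < length (z # ps)"
  have adj': "E (ps ! j) z \<longleftrightarrow> j = 0" if "j < length ps" for j
    using adj[OF that] sym by blast
  show "E ((z # ps) ! i) ((z # ps) ! j) \<longleftrightarrow> j = Suc i \<or> i = Suc j"
    by (cases i; cases j) (use ij in \<open>simp_all add: z(2) adj adj' induced_pathD[OF ps]\<close>)
qed (simp add: z(1) induced_path_distinct[OF ps])

text \<open>The walk is followed from its far end. A new vertex either lies on the path already,
  which is then cut there, or is joined to its last neighbour on the path, skipping everything
  before it.\<close>

lemma induced_path_of_rtrancl:
  assumes irr: "\<And>v. \<not> E v v" and sym: "\<And>u v. E u v \<Longrightarrow> E v u"
    and r: "(x, y) \<in> {(a, b). E a b \<and> a \<in> W \<and> b \<in> W}\<^sup>*" and y: "y \<in> W"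
  shows "\<exists>ps. induced_path E ps \<and> ps \<noteq> [] \<and> hd ps = x \<and> last ps = y \<and> set ps \<subseteq> W"
  using r
proof (induction rule: converse_rtrancl_induct)
  case base
  show ?case by (rule exI[of _ "[y]"]) (use y irr in \<open>auto simp: induced_path_def\<close>)
next
  case (step x z)
  then obtain ps where ps: "induced_path E ps" "ps \<noteq> []" "hd ps = z" "last ps = y" "set ps \<subseteq> W"
    by blast
  have x: "E x z" "x \<in> W" using step by auto
  show ?case
  proof (cases "x \<in> set ps")
    case True
    then obtain i where i: "i < length ps" "ps ! i = x" by (meson in_set_conv_nth)
    then have "hd (drop i ps) = x" "drop i ps \<noteq> []" "last (drop i ps) = y"
      using ps(4) by (auto simp: hd_drop_conv_nth)
    moreover have "set (drop i ps) \<subseteq> W" using ps(5) set_drop_subset by fast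
    ultimately show ?thesis using induced_path_drop[OF ps(1), of i] by blast
  next
    case False
    \<comment> \<open>Beyond index \<open>Max J\<close> no path vertex is adjacent to
      \<open>x\<close>, so attaching \<open>x\<close> there creates no chord.\<close>
    define J where "J = {j. j < length ps \<and> E x (ps ! j)}"
    have finJ: "finite J" unfolding J_def by simp
    have "0 \<in> J" using ps(2,3) x by (auto simp: J_def hd_conv_nth)
    then have maxJ: "Max J \<in> J" using finJ Max_in by blast
    let ?i = "Max J"
    let ?qs = "drop ?i ps"
    have i: "?i < length ps" "E x (ps ! ?i)" using maxJ unfolding J_def by auto
    have "induced_path E (x # ?qs)"
    proof (rule induced_path_Cons[OF induced_path_drop[OF ps(1)] _ irr sym])
      show "x \<notin> set ?qs" using False set_drop_subset by fast
      fix j assume j: "j < length ?qs"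
      show "E x (?qs ! j) \<longleftrightarrow> j = 0"
      proof
        assume "E x (?qs ! j)"
        then have "?i + j \<in> J" using j unfolding J_def by auto
        then show "j = 0" using Max_ge[OF finJ] by fastforce
      qed (use i in auto)
    qed
    moreover have "last (x # ?qs) = y" using i ps(4) by auto
    moreover have "set (x # ?qs) \<subseteq> W" using x(2) ps(5) set_drop_subset by fastforce
    ultimately show ?thesis by (intro exI[of _ "x # ?qs"]) auto
  qed
qed

text \<open>The form of \<open>cross\<close> also covers a path consisting of one vertex, joined to
  both ends of the other path; \<open>leaf_exists\<close> uses that case.\<close>

lemma induced_cycle_append:
  assumes ps: "induced_path E ps" "ps \<noteq> []" and qs: "induced_path E qs" "qs \<noteq> []"
    and len: "3 \<le> length ps + length qs" and V: "set ps \<subseteq> V" "set qs \<subseteq> V"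
    and disj: "set ps \<inter> set qs = {}" and sym: "\<And>u v. E u v \<Longrightarrow> E v u"
    and cross: "\<And>i j. i < length ps \<Longrightarrow> j < length qs \<Longrightarrow>
      E (ps ! i) (qs ! j) \<longleftrightarrow> (Suc i = length ps \<and> j = 0) \<or> (i = 0 \<and> Suc j = length qs)"
  shows "induced_cycle V E (ps @ qs)"
proof -
  let ?m = "length ps" and ?n = "length qs"
  have cross': "E (qs ! j) (ps ! i) \<longleftrightarrow> (Suc i = length ps \<and> j = 0) \<or> (i = 0 \<and> Suc j = length qs)"
    if "i < ?m" "j < ?n" for i j
    using cross[OF that] sym by blast
  have mn: "0 < ?m" "0 < ?n" using ps qs by auto
  \<comment> \<open>Replacing \<open>mod\<close> by a conditional turns the index comparisons into
    linear arithmetic.\<close>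
  have md: "Suc i mod (?m + ?n) = (if Suc i = ?m + ?n then 0 else Suc i)" if "i < ?m + ?n" for i
    using that by auto
  have "E ((ps @ qs) ! i) ((ps @ qs) ! j) \<longleftrightarrow>
      j = Suc i mod (?m + ?n) \<or> i = Suc j mod (?m + ?n)" if ij: "i < ?m + ?n" "j < ?m + ?n" for i j
  proof -
    consider "i < ?m" "j < ?m" | "i < ?m" "\<not> j < ?m" | "\<not> i < ?m" "j < ?m" | "\<not> i < ?m" "\<not> j < ?m"
      by blast
    then show ?thesis
    proof cases
      case 1
      then have "E ((ps @ qs) ! i) ((ps @ qs) ! j) \<longleftrightarrow> (j = Suc i \<or> i = Suc j)"
        using induced_pathD[OF ps(1)] by (simp add: nth_append)
      moreover have "(j = Suc i \<or> i = Suc j) \<longleftrightarrow>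
          j = (if Suc i = ?m + ?n then 0 else Suc i) \<or> i = (if Suc j = ?m + ?n then 0 else Suc j)"
        using 1 mn by arith
      ultimately show ?thesis unfolding md[OF ij(1)] md[OF ij(2)] by simp
    next
      case 2
      then obtain j' where j': "j = ?m + j'" using le_Suc_ex linorder_not_less by blast
      then have "E ((ps @ qs) ! i) ((ps @ qs) ! j) \<longleftrightarrow>
          (Suc i = ?m \<and> j' = 0) \<or> (i = 0 \<and> Suc j' = ?n)"
        using 2 ij cross[of i j'] by (simp add: nth_append)
      moreover have "Suc i \<noteq> ?m + ?n" using 2 mn by linarith
      moreover have "j = Suc i \<longleftrightarrow> Suc i = ?m \<and> j' = 0"
        "i = (if Suc j = ?m + ?n then 0 else Suc j) \<longleftrightarrow> i = 0 \<and> Suc j' = ?n"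
        using 2 mn j' by auto
      ultimately show ?thesis unfolding md[OF ij(1)] md[OF ij(2)] by simp
    next
      case 3
      then obtain i' where i': "i = ?m + i'" using le_Suc_ex linorder_not_less by blast
      then have "E ((ps @ qs) ! i) ((ps @ qs) ! j) \<longleftrightarrow>
          (Suc j = ?m \<and> i' = 0) \<or> (j = 0 \<and> Suc i' = ?n)"
        using 3 ij cross'[of j i'] by (simp add: nth_append)
      moreover have "Suc j \<noteq> ?m + ?n" using 3 mn by linarith
      moreover have "i = Suc j \<longleftrightarrow> Suc j = ?m \<and> i' = 0"
        "j = (if Suc i = ?m + ?n then 0 else Suc i) \<longleftrightarrow> j = 0 \<and> Suc i' = ?n"
        using 3 mn i' by auto
      ultimately show ?thesis unfolding md[OF ij(1)] md[OF ij(2)] by simp (simp only: disj_commute)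
    next
      case 4
      then obtain i' j' where ij': "i = ?m + i'" "j = ?m + j'"
        using le_Suc_ex linorder_not_less by metis
      then have "E ((ps @ qs) ! i) ((ps @ qs) ! j) \<longleftrightarrow> (j' = Suc i' \<or> i' = Suc j')"
        using ij induced_pathD[OF qs(1)] by (simp add: nth_append)
      moreover have "j = (if Suc i = ?m + ?n then 0 else Suc i) \<longleftrightarrow> j' = Suc i'"
        "i = (if Suc j = ?m + ?n then 0 else Suc j) \<longleftrightarrow> i' = Suc j'"
        using ij' ij mn by auto
      ultimately show ?thesis unfolding md[OF ij(1)] md[OF ij(2)] by simp
    qed
  qed
  then show ?thesis
    using len V disj induced_path_distinct[OF ps(1)]
      induced_path_distinct[OF qs(1)] unfolding induced_cycle_def by simp
qed

text \<open>Connectedness of \<open>C\<close> enters through splits, the form in which the case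
  distinction of \<open>sweepable_territory\<close> supplies it: the part of \<open>C\<close>
  reachable from \<open>x\<close> has no edge leaving it inside \<open>C\<close>, hence is all of
  \<open>C\<close> and contains a neighbour of \<open>y\<close>.\<close>

lemma path_through_connected:
  assumes irr: "\<And>v. \<not> E v v" and sym: "\<And>u v. E u v \<Longrightarrow> E v u"
    and con: "\<And>A B. C = A \<union> B \<Longrightarrow> A \<inter> B = {} \<Longrightarrow> A \<noteq> {} \<Longrightarrow> B \<noteq> {} \<Longrightarrow> \<exists>a\<in>A. \<exists>b\<in>B. E a b"
    and x: "x \<in> boundary E C" and y: "y \<in> boundary E C"
  shows "\<exists>ps. induced_path E ps \<and> ps \<noteq> [] \<and> hd ps = x \<and> last ps = y \<and> set ps \<subseteq> C \<union> {x, y}"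
proof -
  let ?W = "C \<union> {x, y}"
  let ?R = "{(a, b). E a b \<and> a \<in> ?W \<and> b \<in> ?W}"
  define A where "A = {c \<in> C. (x, c) \<in> ?R\<^sup>*}"
  obtain c d where c: "c \<in> C" "E c x" and d: "d \<in> C" "E d y"
    using x y unfolding boundary_def by blast
  have "(x, c) \<in> ?R" using c sym by blast
  then have cA: "c \<in> A" using c by (auto simp: A_def)
  have "A = C"
  proof (rule ccontr)
    assume "A \<noteq> C"
    then have "C = A \<union> (C - A)" "C - A \<noteq> {}" by (auto simp: A_def)
    then obtain a b where ab: "a \<in> A" "b \<in> C - A" "E a b"
      using con[of A "C - A"] cA by blast
    then have "(x, a) \<in> ?R\<^sup>*" "(a, b) \<in> ?R" by (auto simp: A_def)
    then have "(x, b) \<in> ?R\<^sup>*" by (rule rtrancl_into_rtrancl)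
    then show False using ab by (auto simp: A_def)
  qed
  then have "(x, d) \<in> ?R\<^sup>*" using d by (auto simp: A_def)
  moreover have "(d, y) \<in> ?R" using d by blast
  ultimately have "(x, y) \<in> ?R\<^sup>*" by (rule rtrancl_into_rtrancl)
  then show ?thesis using induced_path_of_rtrancl[of E x y ?W] irr sym by blast
qed

section \<open>Sweeping a territory along an induced path\<close>

lemma nbhd_insert: "nbhd E (insert v S) = {w. E v w} \<union> nbhd E S"
  unfolding nbhd_def by blast

lemma card_nbhd_le:
  assumes "\<And>v. card {w. E v w} \<le> D"
  shows "card (nbhd E (set ps)) \<le> length ps * D"
proof -
  have "nbhd E (set ps) = (\<Union>v\<in>set ps. {w. E v w})" unfolding nbhd_def by blast
  then have "card (nbhd E (set ps)) \<le> (\<Sum>v\<in>set ps. card {w. E v w})"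
    using card_UN_le[of "set ps"] by simp
  also have "\<dots> \<le> card (set ps) * D" using sum_bounded_above[of "set ps" "\<lambda>v. card {w. E v w}" D] assms by simp
  also have "\<dots> \<le> length ps * D" by (rule mult_le_mono1[OF card_length])
  finally show ?thesis .
qed

text \<open>\<open>P\<close> is closed up by an induced path from \<open>x\<close> to
  \<open>y\<close> with interior in \<open>C\<close>. The interior has no neighbour on
  \<open>P\<close>, and \<open>x\<close> and \<open>y\<close> each see only their own end of
  \<open>P\<close>, so there is no chord.\<close>

lemma induced_cycle_through_territory:
  assumes G: "fin_simple_graph V E"
    and P: "induced_path E P" "2 \<le> length P" "set P \<subseteq> V"
    and C: "C \<subseteq> V" "C \<inter> set P = {}" "C \<inter> nbhd E (set P) = {}"
    and con: "\<And>A B. C = A \<union> B \<Longrightarrow> A \<inter> B = {} \<Longrightarrow> A \<noteq> {} \<Longrightarrow> B \<noteq> {} \<Longrightarrow> \<exists>a\<in>A. \<exists>b\<in>B. E a b"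
    and x: "x \<in> boundary E C" "E (last P) x" "x \<notin> nbhd E (set (butlast P))"
    and y: "y \<in> boundary E C" "E (hd P) y" "y \<notin> nbhd E (set (tl P))"
  shows "\<exists>cs. induced_cycle V E cs \<and> length P + 2 \<le> length cs"
proof -
  have sym: "\<And>u v. E u v \<Longrightarrow> E v u" and irr: "\<And>v. \<not> E v v" and EV: "\<And>u v. E u v \<Longrightarrow> u \<in> V \<and> v \<in> V"
    using G unfolding fin_simple_graph_def by blast+
  obtain qs where qs: "induced_path E qs" "qs \<noteq> []" "hd qs = x" "last qs = y" "set qs \<subseteq> C \<union> {x, y}"
    using path_through_connected[of E C x y] irr sym con x(1) y(1) by blast
  have Pne: "P \<noteq> []" using P(2) by auto
  have bl: "P ! i \<in> set (butlast P)" if "Suc i < length P" for i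
    using that by (metis Suc_lessD length_butlast less_diff_conv nth_butlast nth_mem Suc_eq_plus1)
  have tl: "P ! i \<in> set (tl P)" if "0 < i" "i < length P" for i
    using that by (cases P) auto
  have adj_x: "E (P ! i) x \<longleftrightarrow> Suc i = length P" if i: "i < length P" for i
  proof (cases "Suc i = length P")
    case True
    then show ?thesis using x(2) Pne by (metis diff_Suc_1 last_conv_nth)
  next
    case False
    then show ?thesis using bl[of i] x(3) i unfolding nbhd_def by auto
  qed
  have adj_y: "E (P ! i) y \<longleftrightarrow> i = 0" if i: "i < length P" for i
  proof (cases "i = 0")
    case True
    then show ?thesis using y(2) Pne by (simp add: hd_conv_nth)
  next
    case False
    then show ?thesis using tl[of i] y(3) i unfolding nbhd_def by auto
  qed
  \<comment> \<open>\<open>P\<close> has two different ends and \<open>x\<close>, \<open>y\<close>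
    each see only one of them, so they differ; this yields the \<open>2\<close> in the length
    bound.\<close>
  have ne: "x \<noteq> y" using adj_x[of 0] adj_y[of 0] P(2) by (cases P) auto
  have qx: "qs ! 0 = x" and qy: "qs ! (length qs - 1) = y"
    using qs by (simp_all add: hd_conv_nth last_conv_nth)
  then have len: "2 \<le> length qs" using ne qs(2) by (cases qs; cases "tl qs") auto
  have adj_q: "E (P ! i) (qs ! j) \<longleftrightarrow> (Suc i = length P \<and> j = 0) \<or> (i = 0 \<and> Suc j = length qs)"
    if i: "i < length P" and j: "j < length qs" for i j
  proof -
    consider "j = 0" | "Suc j = length qs" | "j \<noteq> 0" "Suc j \<noteq> length qs" by blast
    then show ?thesis
    proof cases
      case 1
      then show ?thesis using adj_x[OF i] qx len by auto
    next
      case 2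
      then have "qs ! j = y" using qy by (metis diff_Suc_1)
      then show ?thesis using adj_y[OF i] len 2 by auto
    next
      case 3
      moreover have "0 < length qs" "length qs - 1 < length qs" using j by linarith+
      ultimately have "qs ! j \<noteq> x" "qs ! j \<noteq> y"
        using nth_eq_iff_index_eq[OF induced_path_distinct[OF qs(1)] j] qx qy by fastforce+
      then have "qs ! j \<in> C" using qs(5) j nth_mem by fastforce
      then have "\<not> E (P ! i) (qs ! j)" using C(3) nth_mem[OF i] unfolding nbhd_def by blast
      then show ?thesis using 3 by simp
    qed
  qed
  have bnd: "v \<notin> set P" if "v \<in> boundary E C" for v
    using that C(3) sym unfolding boundary_def nbhd_def by blast
  have "x \<in> V" "y \<in> V" using x(2) y(2) EV by blast+
  then have "set qs \<subseteq> V" using qs(5) C(1) by blast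
  moreover have "set P \<inter> set qs = {}" using qs(5) C(2) bnd x(1) y(1) by blast
  ultimately have "induced_cycle V E (P @ qs)"
    using P(2) len by (intro induced_cycle_append[OF P(1) Pne qs(1,2) _ P(3) _ _ sym adj_q]) auto
  then show ?thesis using len by (intro exI[of _ "P @ qs"]) simp
qed

text \<open>The standing cops occupy \<open>boundary E C\<close>, a part of
  \<open>nbhd E (set P)\<close>, so at most \<open>length P * D\<close> of them are in use. The
  measure counts \<open>C\<close> twice so that one vertex lost from \<open>C\<close> pays for a
  path longer by one.\<close>

lemma sweepable_territory:
  assumes G: "fin_simple_graph V E" and deg: "\<And>v. card {w. E v w} \<le> D" and D: "1 \<le> D" and m: "2 \<le> m"
    and short: "\<And>cs. induced_cycle V E cs \<Longrightarrow> length cs < m + 2"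
  shows "\<lbrakk>induced_path E P; length P \<le> m; set P \<subseteq> V; C \<subseteq> V; C \<inter> set P = {};
    C \<inter> nbhd E (set P) = {}; boundary E C \<subseteq> nbhd E (set P)\<rbrakk>
    \<Longrightarrow> sweepable E (m * D) (boundary E C) C"
proof (induction "2 * card C + length P" arbitrary: C P rule: less_induct)
  case less
  have sym: "\<And>u v. E u v \<Longrightarrow> E v u" and irr: "\<And>v. \<not> E v v"
    and EV: "\<And>u v. E u v \<Longrightarrow> u \<in> V \<and> v \<in> V" and finV: "finite V"
    using G unfolding fin_simple_graph_def by blast+
  have finC: "finite C" using less.prems(4) finV finite_subset by blast
  have finb: "finite (boundary E C)"
    by (rule finite_subset[OF _ finV]) (use EV in \<open>auto simp: boundary_def\<close>)
  have finN: "finite (nbhd E Q)" for Q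
    by (rule finite_subset[OF _ finV]) (use EV in \<open>auto simp: nbhd_def\<close>)
  \<comment> \<open>Once \<open>A\<close> is occupied, the outer neighbours of \<open>C - A\<close>
    lie in \<open>boundary E C \<union> A\<close>; the cops off the new boundary are lifted by
    \<open>sweepable_mono\<close>.\<close>
  have step: "sweepable E (m * D) (boundary E C) C"
    if A: "A \<subseteq> C" and card: "card (boundary E C \<union> A) \<le> m * D"
      and sw: "sweepable E (m * D) (boundary E (C - A)) (C - A)" for A
  proof (rule sweepable_place_set[OF finite_subset[OF A finC] A finb _ card])
    show "boundary E C \<inter> C = {}" by (auto simp: boundary_def)
    show "sweepable E (m * D) (boundary E C \<union> A) (C - A)"
      by (rule sweepable_mono[OF sw _ _ sym]) (auto simp: boundary_def)
  qed
  consider "C = {}"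
    | A B where "C = A \<union> B" "A \<inter> B = {}" "A \<noteq> {}" "B \<noteq> {}" "\<And>a b. a \<in> A \<Longrightarrow> b \<in> B \<Longrightarrow> \<not> E a b"
    | "C \<noteq> {}" "\<And>A B. C = A \<union> B \<Longrightarrow> A \<inter> B = {} \<Longrightarrow> A \<noteq> {} \<Longrightarrow> B \<noteq> {} \<Longrightarrow> \<exists>a\<in>A. \<exists>b\<in>B. E a b"
    by metis
  then show ?case
  proof cases
    case 1
    then show ?thesis by (simp add: sweepable_empty)
  next
    case (2 A B)
    \<comment> \<open>Without edges between the parts, each part is bordered only by the border of
      \<open>C\<close>, and \<open>P\<close> still guides both.\<close>
    have bA: "boundary E A \<subseteq> boundary E C" and bB: "boundary E B \<subseteq> boundary E C"
      using 2(1,5) sym unfolding boundary_def by blast+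
    have "card A < card C" "card B < card C"
      using 2(1-4) finC by (auto intro!: psubset_card_mono)
    then have sw: "sweepable E (m * D) (boundary E A) A" "sweepable E (m * D) (boundary E B) B"
      using less.prems bA bB 2(1) by (auto intro!: less.hyps[of _ P])
    have disj: "boundary E C \<inter> A = {}" "boundary E C \<inter> B = {}" "boundary E C \<inter> (A \<union> B) = {}"
      using 2(1) by (auto simp: boundary_def)
    have "finite A" using 2(1) finC by blast
    then have "sweepable E (m * D) (boundary E C) (A \<union> B)"
      using sweepable_Un[OF sweepable_mono[OF sw(1) bA disj(1) sym order_refl]
        sweepable_mono[OF sw(2) bB disj(2) sym order_refl] _ 2(2) disj(3) sym 2(5)] by blast
    then show ?thesis using 2(1) by simp
  next
    case 3
    show ?thesis
    proof (cases "P = []")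
      case True
      then have b0: "boundary E C = {}" using less.prems(7) by (simp add: nbhd_def)
      obtain v where v: "v \<in> C" using 3(1) by blast
      \<comment> \<open>With an empty border any \<open>v\<close> may start. It and its neighbours
        need at most \<open>D + 1\<close> cops, within \<open>m * D\<close> because
        \<open>1 \<le> D\<close> and \<open>2 \<le> m\<close>.\<close>
      let ?A = "insert v {w. E v w}"
      have A: "?A \<subseteq> C" using v b0 unfolding boundary_def by blast
      have "card ?A \<le> Suc D" using card_insert_le_m1[of "Suc D" "{w. E v w}" v] deg by simp
      also have "\<dots> \<le> 2 * D" using D by simp
      also have "\<dots> \<le> m * D" using m by simp
      finally have card: "card (boundary E C \<union> ?A) \<le> m * D" using b0 by simp
      show ?thesis
      proof (rule step[OF A card])
        have "card (C - ?A) < card C" using v finC by (intro psubset_card_mono) auto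
        then have lt: "2 * card (C - ?A) + length [v] < 2 * card C + length P" by simp
        have "induced_path E [v]" using irr by (simp add: induced_path_def)
        moreover have "boundary E (C - ?A) \<subseteq> nbhd E (set [v])"
          using b0 sym unfolding boundary_def nbhd_def by auto
        ultimately show "sweepable E (m * D) (boundary E (C - ?A)) (C - ?A)"
          using less.hyps[OF lt] m v less.prems(4) by (auto simp: nbhd_def)
      qed
    next
      case False
      have short_P: ?thesis if Q: "Q = take n P \<or> Q = drop n P" "length Q < length P"
        "boundary E C \<subseteq> nbhd E (set Q)" for Q n
      proof (rule less.hyps[of C Q])
        have sub: "set Q \<subseteq> set P" using Q(1) set_take_subset set_drop_subset by fast
        show "induced_path E Q"
          using Q(1) less.prems(1) induced_path_take induced_path_drop by blast
        show "C \<inter> nbhd E (set Q) = {}" using sub less.prems(6) unfolding nbhd_def by blast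
      qed (use Q less.prems set_take_subset set_drop_subset in \<open>auto dest: in_set_takeD in_set_dropD\<close>)
      have PhC: "set P = insert (hd P) (set (tl P))" using False by (cases P) auto
      have Pl: "set P = insert (last P) (set (butlast P))"
        using append_butlast_last_id[OF False] by (metis Un_insert_right list.simps(15) set_append sup_bot_right empty_set)
      consider "boundary E C \<subseteq> nbhd E (set (tl P))" | "boundary E C \<subseteq> nbhd E (set (butlast P))"
        | x y where "x \<in> boundary E C" "E (last P) x" "x \<notin> nbhd E (set (butlast P))"
           "y \<in> boundary E C" "E (hd P) y" "y \<notin> nbhd E (set (tl P))"
      proof -
        have "nbhd E (set P) = {w. E (hd P) w} \<union> nbhd E (set (tl P))"
          "nbhd E (set P) = {w. E (last P) w} \<union> nbhd E (set (butlast P))"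
          using nbhd_insert PhC Pl by metis+
        then show ?thesis using less.prems(7) that by blast
      qed
      then show ?thesis
      proof cases
        case 1
        then show ?thesis using short_P[of "tl P" 1] False by (simp add: drop_Suc)
      next
        case 2
        then show ?thesis using short_P[of "butlast P" "length P - 1"] False by (simp add: butlast_conv_take)
      next
        case xy: (3 x y)
        \<comment> \<open>A path with two or more vertices closes up to a cycle with at least
          \<open>length P + 2\<close> vertices, and \<open>short\<close> keeps that below
          \<open>m + 2\<close>. A shorter path has room because \<open>2 \<le> m\<close>.\<close>
        have lenP: "Suc (length P) \<le> m"
        proof (cases "2 \<le> length P")
          case True
          then obtain cs where "induced_cycle V E cs" "length P + 2 \<le> length cs"
            using induced_cycle_through_territory[OF G less.prems(1) _ less.prems(3-6) 3(2) xy] by blast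
          then show ?thesis using short by fastforce
        qed (use m in simp)
        \<comment> \<open>\<open>y\<close> becomes the new head; occupying its neighbours in
          \<open>C\<close> makes the remaining territory avoid the neighbourhood of
          \<open>y # P\<close>.\<close>
        let ?A = "C \<inter> {w. E y w}"
        have Np: "nbhd E (set (y # P)) = {w. E y w} \<union> nbhd E (set P)" by (simp add: nbhd_insert)
        have "boundary E C \<union> ?A \<subseteq> nbhd E (set (y # P))" using less.prems(7) Np by blast
        then have "card (boundary E C \<union> ?A) \<le> card (nbhd E (set (y # P)))"
          by (rule card_mono[OF finN])
        also have "\<dots> \<le> length (y # P) * D" by (rule card_nbhd_le[OF deg])
        also have "\<dots> \<le> m * D" using lenP by (simp only: list.size mult_le_mono1 add_Suc_right add_0_right)
        finally have card: "card (boundary E C \<union> ?A) \<le> m * D" .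
        show ?thesis
        proof (rule step[OF _ card])
          obtain c where c: "c \<in> C" "E c y" and yC: "y \<notin> C" using xy(4) unfolding boundary_def by blast
          have "c \<in> ?A" using c sym by blast
          then have "card (C - ?A) < card C" using c finC by (intro psubset_card_mono) auto
          then have lt: "2 * card (C - ?A) + length (y # P) < 2 * card C + length P" by simp
          have yP: "y \<notin> set P" using c less.prems(6) sym unfolding nbhd_def by blast
          have path: "induced_path E (y # P)"
          proof (rule induced_path_Cons[OF less.prems(1) yP irr sym])
            fix j assume j: "j < length P"
            show "E y (P ! j) \<longleftrightarrow> j = 0"
            proof (cases j)
              case 0
              then show ?thesis using xy(5) False sym by (simp add: hd_conv_nth)
            next
              case (Suc k)
              then have "P ! j \<in> set (tl P)" using j by (cases P) auto
              then show ?thesis using Suc xy(6) sym unfolding nbhd_def by blast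
            qed
          qed
          have "boundary E (C - ?A) \<subseteq> nbhd E (set (y # P))"
            using less.prems(7) unfolding Np boundary_def by blast
          moreover have "(C - ?A) \<inter> nbhd E (set (y # P)) = {}" using less.prems(6) unfolding Np by blast
          moreover have "set (y # P) \<subseteq> V" "(C - ?A) \<inter> set (y # P) = {}" "C - ?A \<subseteq> V"
            using c(2) EV yC less.prems(3-5) by auto
          moreover have "length (y # P) \<le> m" using lenP by simp
          ultimately show "sweepable E (m * D) (boundary E (C - ?A)) (C - ?A)"
            by (intro less.hyps[OF lt path])
        qed blast
      qed
    qed
  qed
qed

section \<open>Forests: depth-first layouts and boxes in the plane\<close>

text \<open>The head of a longest induced path is a leaf.\<close>

lemma leaf_exists:
  assumes G: "fin_simple_graph V E" and nocyc: "\<And>cs. \<not> induced_cycle V E cs"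
    and W: "W \<subseteq> V" "W \<noteq> {}"
  shows "\<exists>v\<in>W. \<forall>a\<in>W. \<forall>b\<in>W. E v a \<and> E v b \<longrightarrow> a = b"
proof -
  have sym: "\<And>u v. E u v \<Longrightarrow> E v u" and irr: "\<And>v. \<not> E v v" and finV: "finite V"
    using G unfolding fin_simple_graph_def by blast+
  have finW: "finite W" using W finV finite_subset by blast
  let ?Q = "\<lambda>ps. induced_path E ps \<and> set ps \<subseteq> W \<and> ps \<noteq> []"
  obtain v where "v \<in> W" using W by blast
  then have "?Q [v]" using irr by (simp add: induced_path_def)
  moreover have "length ps \<le> card W" if "?Q ps" for ps
    using that card_mono[OF finW, of "set ps"] distinct_card[OF induced_path_distinct, of E ps] by simp
  ultimately obtain P where P: "?Q P" and max: "\<And>ps. ?Q ps \<Longrightarrow> length ps \<le> length P"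
    using ex_has_greatest_nat[of ?Q "[v]" length "Suc (card W)"] by (metis less_Suc_eq_le)
  \<comment> \<open>A neighbour off \<open>P\<close> would either prolong \<open>P\<close> or close
    an induced cycle with an initial segment of it. If \<open>P\<close> has a single vertex,
    \<open>P ! 1\<close> is unspecified, but the same argument shows that no such \<open>z\<close>
    exists.\<close>
  have "z = P ! 1" if z: "z \<in> W" "E (hd P) z" for z
  proof (cases "z \<in> set P")
    case True
    then obtain j where j: "j < length P" "P ! j = z" by (meson in_set_conv_nth)
    then have "j = 1" using induced_pathD[of E P 0 j] P z(2) by (simp add: hd_conv_nth)
    then show ?thesis using j by simp
  next
    case False
    define J where "J = {j. j < length P \<and> 0 < j \<and> E z (P ! j)}"
    have z0: "E z (P ! 0)" using z(2) P sym by (simp add: hd_conv_nth)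
    show ?thesis
    proof (cases "J = {}")
      case True
      have "induced_path E (z # P)"
        using P False irr sym z0 True unfolding J_def by (intro induced_path_Cons) auto
      then show ?thesis using max[of "z # P"] P z(1) by simp
    next
      case False
      \<comment> \<open>The nearest neighbour of \<open>z\<close> beyond the head is chosen so that
        \<open>z\<close> has no chord into the segment.\<close>
      define k where "k = Min J"
      have finJ: "finite J" by (simp add: J_def)
      then have "k \<in> J" using False k_def Min_in by blast
      then have k: "k < length P" "0 < k" "E z (P ! k)" by (auto simp: J_def)
      have kmin: "\<not> E z (P ! i)" if "0 < i" "i < k" for i
        using that Min_le[OF finJ, of i] k(1) unfolding k_def J_def by fastforce
      have sub: "set (take (Suc k) P) \<subseteq> set P" by (rule set_take_subset)
      have "induced_cycle V E (take (Suc k) P @ [z])"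
      proof (rule induced_cycle_append)
        show "induced_path E (take (Suc k) P)" using P induced_path_take by blast
        show "induced_path E [z]" using irr by (simp add: induced_path_def)
        show "set (take (Suc k) P) \<subseteq> V" "set [z] \<subseteq> V" using sub P W z by auto
        show "set (take (Suc k) P) \<inter> set [z] = {}" using sub \<open>z \<notin> set P\<close> by auto
        fix i j assume ij: "i < length (take (Suc k) P)" "j < length [z]"
        then have "E (P ! i) z \<longleftrightarrow> i = k \<or> i = 0"
          using k z0 kmin[of i] sym by (metis gr0I less_Suc_eq length_take min_less_iff_conj)
        then show "E (take (Suc k) P ! i) ([z] ! j) \<longleftrightarrow>
            Suc i = length (take (Suc k) P) \<and> j = 0 \<or> i = 0 \<and> Suc j = length [z]"
          using ij k by auto
      qed (use k P sym in auto)
      then show ?thesis using nocyc by blast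
    qed
  qed
  then show ?thesis using P by (intro bexI[of _ "hd P"]) (auto intro: hd_in_set)
qed

text \<open>\<open>pos\<close> is a depth-first numbering and \<open>dep\<close> the depth.\<close>

definition forest_layout :: "('a \<Rightarrow> 'a \<Rightarrow> bool) \<Rightarrow> 'a set \<Rightarrow> ('a \<Rightarrow> nat) \<Rightarrow> ('a \<Rightarrow> nat) \<Rightarrow> bool" where
  "forest_layout E W pos dep \<longleftrightarrow> inj_on pos W \<and>
     (\<forall>u\<in>W. \<forall>w\<in>W. pos u < pos w \<longrightarrow>
        (E u w \<longrightarrow> dep w = dep u + 1) \<and>
        (\<not> E u w \<longrightarrow> (\<forall>z\<in>W. E u z \<and> pos w \<le> pos z \<longrightarrow> dep u + 2 \<le> dep w)))"

lemma forest_layoutD: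
  assumes "forest_layout E W pos dep" "u \<in> W" "w \<in> W" "pos u < pos w"
  shows "E u w \<Longrightarrow> dep w = dep u + 1"
    and "\<not> E u w \<Longrightarrow> z \<in> W \<Longrightarrow> E u z \<Longrightarrow> pos w \<le> pos z \<Longrightarrow> dep u + 2 \<le> dep w"
  using assms unfolding forest_layout_def by blast+

text \<open>A leaf is removed, the rest is laid out by induction, and the leaf is put back
  immediately after its neighbour, one level deeper.\<close>

lemma forest_layout_exists:
  assumes G: "fin_simple_graph V E" and nocyc: "\<And>cs. \<not> induced_cycle V E cs"
  shows "W \<subseteq> V \<Longrightarrow> \<exists>pos dep. forest_layout E W pos dep"
proof (induction "card W" arbitrary: W)
  case 0
  then have "W = {}" using G finite_subset unfolding fin_simple_graph_def by fastforce
  then show ?case by (simp add: forest_layout_def)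
next
  case (Suc n)
  have sym: "\<And>u v. E u v \<Longrightarrow> E v u" and irr: "\<And>v. \<not> E v v"
    using G unfolding fin_simple_graph_def by blast+
  have "W \<noteq> {}" using Suc.hyps(2) by auto
  then obtain v where v: "v \<in> W" and leaf: "\<And>a b. a \<in> W \<Longrightarrow> b \<in> W \<Longrightarrow> E v a \<Longrightarrow> E v b \<Longrightarrow> a = b"
    using leaf_exists[OF G nocyc Suc.prems] by blast
  have "n = card (W - {v})" using Suc.hyps(2) v by simp
  then obtain pos dep where L: "forest_layout E (W - {v}) pos dep"
    using Suc.hyps(1)[of "W - {v}"] Suc.prems by blast
  have inj: "inj_on pos (W - {v})" using L unfolding forest_layout_def by blast
  show ?case
  proof (cases "\<exists>u\<in>W. E v u")
    case False
    then have iso: "\<not> E v u" "\<not> E u v" if "u \<in> W" for u using that sym by blast+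
    \<comment> \<open>An isolated vertex goes in front of all others.\<close>
    define pos' where "pos' = (\<lambda>x. Suc (pos x))(v := 0)"
    have p: "pos' v = 0" "\<And>x. x \<noteq> v \<Longrightarrow> pos' x = Suc (pos x)" by (auto simp: pos'_def)
    have "forest_layout E W pos' dep"
      unfolding forest_layout_def
    proof (intro conjI ballI impI)
      show "inj_on pos' W" using inj by (auto simp: inj_on_def pos'_def)
    next
      fix a w assume a: "a \<in> W" "w \<in> W" "pos' a < pos' w" "E a w"
      then have "a \<in> W - {v}" "w \<in> W - {v}" using iso by auto
      then show "dep w = dep a + 1" using forest_layoutD(1)[OF L, of a w] a p by auto
    next
      fix a w z assume a: "a \<in> W" "w \<in> W" "pos' a < pos' w" "\<not> E a w" "z \<in> W" "E a z \<and> pos' w \<le> pos' z"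
      then have "a \<in> W - {v}" "w \<in> W - {v}" "z \<in> W - {v}" using iso p by auto
      then show "dep a + 2 \<le> dep w" using forest_layoutD(2)[OF L, of a w z] a p by auto
    qed
    then show ?thesis by blast
  next
    case True
    then obtain u where u: "u \<in> W" "E v u" by blast
    then have uv: "u \<noteq> v" "u \<in> W - {v}" using irr by auto
    have only: "a = u" if "a \<in> W" "E a v" for a using leaf[OF that(1) u(1)] that sym u by blast
    have only': "a = u" if "a \<in> W" "E v a" for a using leaf[OF that(1) u(1)] that u by blast
    \<comment> \<open>Doubling the times leaves the odd slot right after \<open>u\<close> free for
      the leaf \<open>v\<close>.\<close>
    define pos' where "pos' = (\<lambda>x. 2 * pos x)(v := 2 * pos u + 1)"
    define dep' where "dep' = dep(v := dep u + 1)"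
    have p: "pos' v = 2 * pos u + 1" "\<And>x. x \<noteq> v \<Longrightarrow> pos' x = 2 * pos x" by (auto simp: pos'_def)
    have d: "dep' v = dep u + 1" "\<And>x. x \<noteq> v \<Longrightarrow> dep' x = dep x" by (auto simp: dep'_def)
    have "forest_layout E W pos' dep'"
      unfolding forest_layout_def
    proof (intro conjI ballI impI)
      have odd: "2 * pos u + 1 \<noteq> 2 * pos x" "2 * pos x \<noteq> 2 * pos u + 1" for x by presburger+
      show "inj_on pos' W"
      proof (rule inj_onI)
        fix x y assume xy: "x \<in> W" "y \<in> W" "pos' x = pos' y"
        show "x = y"
          using xy p odd inj_onD[OF inj, of x y] by (cases "x = v"; cases "y = v") auto
      qed
    next
      fix a w assume a: "a \<in> W" "w \<in> W" "pos' a < pos' w" "E a w"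
      consider "a = v" | "w = v" | "a \<in> W - {v}" "w \<in> W - {v}" using a by blast
      then show "dep' w = dep' a + 1"
      proof cases
        case 1
        then have "w = u" using a only' by blast
        then show ?thesis using 1 a(3) p uv by simp
      next
        case 2
        then have "a = u" using a only by blast
        then show ?thesis using 2 d uv by simp
      next
        case 3
        then show ?thesis using forest_layoutD(1)[OF L, of a w] a p d by simp
      qed
    next
      fix a w z assume a: "a \<in> W" "w \<in> W" "pos' a < pos' w" "\<not> E a w" "z \<in> W" "E a z \<and> pos' w \<le> pos' z"
      consider "a = v" | "a \<noteq> v" "w = v" | "a \<noteq> v" "w \<noteq> v" "z = v" | "a \<noteq> v" "w \<noteq> v" "z \<noteq> v" by blast
      then show "dep' a + 2 \<le> dep' w"
      proof cases
        case 1
        then have "z = u" using a only' by blast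
        then show ?thesis using 1 a p uv by simp
      next
        case 2
        have au: "a \<noteq> u" using 2 a(4) u(2) sym by blast
        have zv: "z \<noteq> v" using 2 a(4,6) by blast
        have "pos a \<noteq> pos u" using inj_onD[OF inj, of a u] au 2 a(1) uv by blast
        then have lt: "pos a < pos u" using 2 a(3) p by simp
        have "pos u \<le> pos z" using 2 a(6) p zv by simp
        \<comment> \<open>The edge from \<open>a\<close> to \<open>z\<close> reaches over
          \<open>u\<close>, so \<open>u\<close> is one level below \<open>a\<close> if adjacent to
          it and at least two otherwise; the leaf \<open>v\<close> lies one level further
          down.\<close>
        then have "dep a + 1 \<le> dep u"
          using forest_layoutD[OF L _ uv(2) lt] 2 a zv by fastforce
        then show ?thesis using 2 d by simp
      next
        case 3
        then have "a = u" using a only by blast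
        then show ?thesis using 3 a p by simp
      next
        case 4
        then show ?thesis using forest_layoutD(2)[OF L, of a w z] a p d by simp
      qed
    qed
    then show ?thesis by blast
  qed
qed

text \<open>A vertex \<open>w\<close> after \<open>u\<close> that meets it in coordinate 0 comes no
  later than some neighbour of \<open>u\<close>. If \<open>w\<close> is not adjacent to
  \<open>u\<close>, it is at least two levels deeper, and the depth intervals of length one are
  disjoint.\<close>

lemma box_rep_forest:
  assumes G: "fin_simple_graph V E" and nocyc: "\<And>cs. \<not> induced_cycle V E cs"
  shows "\<exists>B. box_rep V E 2 B"
proof -
  have fin: "finite V" and sym: "\<And>u v. E u v \<Longrightarrow> E v u" and EV: "\<And>u v. E u v \<Longrightarrow> u \<in> V \<and> v \<in> V"
    using G unfolding fin_simple_graph_def by blast+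
  obtain pos dep where L: "forest_layout E V pos dep"
    using forest_layout_exists[OF G nocyc] by blast
  have inj: "inj_on pos V" using L unfolding forest_layout_def by blast
  define hi where "hi v = Max (pos ` insert v {w. E v w})" for v
  have finn: "finite {w. E v w}" for v
    using fin EV by (auto intro: finite_subset[of _ V])
  have hi_ge: "pos v \<le> hi v" "E v w \<Longrightarrow> pos w \<le> hi v" for v w
    unfolding hi_def using finn by (auto intro!: Max_ge)
  have hi_wit: "\<exists>w. (w = v \<or> E v w) \<and> pos w = hi v" for v
    using Max_in[of "pos ` insert v {w. E v w}"] finn unfolding hi_def by auto
  define B :: "'a \<Rightarrow> nat \<Rightarrow> real \<times> real" where
    "B v i = (if i = 0 then (real (pos v), real (hi v)) else (real (dep v), real (dep v + 1)))" for v i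
  have le: "fst (B v i) \<le> snd (B v i)" for v i
    using hi_ge(1)[of v] unfolding B_def by auto
  have meet: "({fst (B u i)..snd (B u i)} \<inter> {fst (B v i)..snd (B v i)} \<noteq> {}) \<longleftrightarrow>
      fst (B u i) \<le> snd (B v i) \<and> fst (B v i) \<le> snd (B u i)" for u v i
    using intervals_meet_iff le by blast
  have iff: "E u w \<longleftrightarrow> (\<forall>i<2. fst (B u i) \<le> snd (B w i) \<and> fst (B w i) \<le> snd (B u i))"
    if lt: "pos u < pos w" and V: "u \<in> V" "w \<in> V" for u w
  proof
    assume uw: "E u w"
    show "\<forall>i<2. fst (B u i) \<le> snd (B w i) \<and> fst (B w i) \<le> snd (B u i)"
      using forest_layoutD(1)[OF L V lt uw] hi_ge(2)[OF uw] hi_ge(1)[of w] lt unfolding B_def by auto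
  next
    assume *: "\<forall>i<2. fst (B u i) \<le> snd (B w i) \<and> fst (B w i) \<le> snd (B u i)"
    from *[rule_format, of 0] have "pos w \<le> hi u" by (simp add: B_def)
    then obtain z where "E u z" "pos w \<le> pos z" using hi_wit[of u] lt by auto
    moreover from *[rule_format, of 1] have "dep w \<le> dep u + 1" by (simp add: B_def)
    ultimately show "E u w" using forest_layoutD(2)[OF L V lt] EV by fastforce
  qed
  have "box_rep V E 2 B"
    unfolding box_rep_def
  proof (intro conjI ballI allI impI)
    fix u v assume uv: "u \<in> V" "v \<in> V" "u \<noteq> v"
    then have "pos u < pos v \<or> pos v < pos u" using inj_on_eq_iff[OF inj, of u v] by linarith
    then show "E u v \<longleftrightarrow> (\<forall>i<2. {fst (B u i)..snd (B u i)} \<inter> {fst (B v i)..snd (B v i)} \<noteq> {})"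
      using iff[of u v] iff[of v u] meet uv sym by metis
  qed (use le in auto)
  then show ?thesis by blast
qed

section \<open>The logarithmic bound\<close>

lemma boxicity_le: "box_rep V E d B \<Longrightarrow> boxicity V E \<le> d"
  unfolding boxicity_def by (rule Least_le) blast

lemma mult_le_power_nat:
  fixes D m :: nat
  assumes "2 \<le> D"
  shows "m * D \<le> D ^ m"
proof (induction m)
  case (Suc m)
  show ?case
  proof (cases "m = 0")
    case False
    then have "Suc m \<le> m * 2" by simp
    also have "\<dots> \<le> m * D" using assms by simp
    also have "\<dots> \<le> D ^ m" by (rule Suc.IH)
    finally show ?thesis by (simp only: power_Suc2 mult_le_mono1)
  qed simp
qed simp

theorem theorem14:
  fixes V :: "'a set" and E :: "'a \<Rightarrow> 'a \<Rightarrow> bool"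
  assumes "fin_simple_graph V E"
    and "boxicity V E \<ge> 3"
  shows "\<exists>cs. induced_cycle V E cs \<and>
     real (length cs) \<ge> of_int \<lfloor>log (real (max_degree V E)) (real (boxicity V E) - 2)\<rfloor> + 2"
proof -
  let ?D = "max_degree V E" and ?b = "boxicity V E"
  define k where "k = \<lfloor>log (real ?D) (real ?b - 2)\<rfloor>"
  \<comment> \<open>Boxicity at least 3 rules out a graph without induced cycles.\<close>
  obtain cs0 where cs0: "induced_cycle V E cs0"
    using box_rep_forest[OF assms(1)] boxicity_le[of V E 2] assms(2) by fastforce
  have "\<exists>cs. induced_cycle V E cs \<and> k + 2 \<le> int (length cs)"
  proof (cases "k \<le> 1")
    case True
    \<comment> \<open>Here \<open>k + 2 \<le> 3\<close>, so any induced cycle is long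
      enough.\<close>
    then show ?thesis using cs0 by (intro exI[of _ cs0]) (auto simp: induced_cycle_def)
  next
    case False
    define m where "m = nat k"
    have m: "2 \<le> m" "int m = k" using False by (auto simp: m_def)
    have finV: "finite V" and EV: "\<And>u v. E u v \<Longrightarrow> u \<in> V \<and> v \<in> V"
      using assms(1) unfolding fin_simple_graph_def by blast+
    \<comment> \<open>For base 0 or 1 the conventions for \<open>log\<close> give the value 0,
      against \<open>k > 1\<close>.\<close>
    have D: "2 \<le> ?D"
    proof (rule ccontr)
      assume "\<not> 2 \<le> ?D"
      then have "?D = 0 \<or> ?D = 1" by linarith
      then have "k = 0" unfolding k_def log_def by auto
      then show False using False by simp
    qed
    have deg: "card {w. E v w} \<le> ?D" for v
    proof (cases "v \<in> V")
      case True
      have "{w. E v w} = {w \<in> V. E v w}" using EV by blast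
      then show ?thesis using True finV unfolding max_degree_def degree_def by (auto intro!: Max_ge)
    next
      case False
      then have "{w. E v w} = {}" using EV by blast
      then show ?thesis by simp
    qed
    \<comment> \<open>Undoing the logarithm turns the definition of \<open>k\<close> into
      \<open>?D ^ m + 2 \<le> ?b\<close>.\<close>
    have "real m \<le> log (real ?D) (real ?b - 2)"
      using m(2) of_int_floor_le[of "log (real ?D) (real ?b - 2)"] unfolding k_def[symmetric]
      by (metis of_int_of_nat_eq)
    then have "real ?D powr real m \<le> real ?b - 2"
      using D assms(2) by (subst (asm) le_log_iff) auto
    then have "real (?D ^ m + 2) \<le> real ?b" using D by (simp add: powr_realpow)
    then have pow: "?D ^ m + 2 \<le> ?b" by linarith
    show ?thesis
    proof (rule ccontr)
      assume "\<nexists>cs. induced_cycle V E cs \<and> k + 2 \<le> int (length cs)"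
      then have short: "length cs < m + 2" if "induced_cycle V E cs" for cs
        using that m(2) by force
      \<comment> \<open>The sweep starts with territory \<open>V\<close>, which has no outer
        neighbours, and the empty path.\<close>
      have b0: "boundary E V = {}" using EV by (auto simp: boundary_def)
      have "sweepable E (m * ?D) (boundary E V) V"
        by (rule sweepable_territory[OF assms(1) deg _ m(1) short, of "[]"])
          (use D b0 in \<open>auto simp: induced_path_def nbhd_def\<close>)
      then obtain B where "box_rep V E (Suc (m * ?D)) B"
        using box_rep_of_sweepable[OF assms(1)] b0 by metis
      \<comment> \<open>Now \<open>?b \<le> m * ?D + 1 \<le> ?D ^ m + 1\<close>, one less than the
        lower bound in \<open>pow\<close>.\<close>
      then have "?b \<le> Suc (m * ?D)" by (rule boxicity_le)
      then show False using mult_le_power_nat[OF D, of m] pow by linarith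
    qed
  qed
  then show ?thesis unfolding k_def[symmetric]
    by (metis (no_types, lifting) of_int_add of_int_le_iff of_int_numeral of_int_of_nat_eq)
qed

end
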